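(* Let $\Omega$ be a simply connected proper subdomain of the plane $\mathbb{C}$ and let $g$ be a conformal map from $\mathbb{D}$ onto $\Omega$. Then $g\in T[H^\infty]$ if and only if $J_{g(0)}$ is a bounded operator on $H^\infty(\Omega)$.
   Context: $\mathbb{D}$ is the open unit disk and $H^\infty$ is the Banach space of bounded analytic functions on $\mathbb{D}$ with the supremum norm. For $g$ analytic on $\mathbb{D}$, $T_gf(z)=\int_0^z f(t)g'(t)\,dt$, $z\in\mathbb{D}$, and $T[H^\infty]$ is the set of analytic $g$ on $\mathbb{D}$ such that $T_g$ is a bounded operator from $H^\infty$ into $H^\infty$. A conformal map is an analytic injective map. For a simply connected domain $\Omega$ and $w_0\in\Omega$, $J_{w_0}$ is the linear operator taking a holomorphic function $f$ on $\Omega$ to the holomorphic function $J_{w_0}f(w)=\int_{w_0}^w f(t)\,dt$, $w\in\Omega$, the integral being over any smooth curve in $\Omega$ from $w_0$ to $w$. $H^\infty(\Omega)$ is the space of bounded holomorphic functions on $\Omega$ with the supremum norm. *)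

theory Defs
  imports "HOL-Complex_Analysis.Complex_Analysis"
begin

text \<open>
  Functions on a set \<open>S\<close> are represented by total functions \<open>complex \<Rightarrow> complex\<close> of which only
  the values on \<open>S\<close> matter.
\<close>

definition Hinf :: "complex set \<Rightarrow> (complex \<Rightarrow> complex) set"
  where "Hinf S = {f. f holomorphic_on S \<and> bounded (f ` S)}"

definition sup_norm :: "complex set \<Rightarrow> (complex \<Rightarrow> complex) \<Rightarrow> real"
  where "sup_norm S f = (SUP z\<in>S. norm (f z))"

text \<open>Linearity is required as an identity of functions on \<open>S\<close>.\<close>

definition bounded_operator_Hinf ::
    "complex set \<Rightarrow> ((complex \<Rightarrow> complex) \<Rightarrow> complex \<Rightarrow> complex) \<Rightarrow> bool"
  where "bounded_operator_Hinf S T \<longleftrightarrow>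
    (\<forall>f\<in>Hinf S. T f \<in> Hinf S) \<and>
    (\<forall>f\<in>Hinf S. \<forall>h\<in>Hinf S. \<forall>z\<in>S. T (\<lambda>t. f t + h t) z = T f z + T h z) \<and>
    (\<forall>f\<in>Hinf S. \<forall>c. \<forall>z\<in>S. T (\<lambda>t. c * f t) z = c * T f z) \<and>
    (\<exists>C. \<forall>f\<in>Hinf S. sup_norm S (T f) \<le> C * sup_norm S f)"

definition T_op :: "(complex \<Rightarrow> complex) \<Rightarrow> (complex \<Rightarrow> complex) \<Rightarrow> complex \<Rightarrow> complex"
  where "T_op g f z = contour_integral (linepath 0 z) (\<lambda>t. f t * deriv g t)"

definition T_Hinf :: "(complex \<Rightarrow> complex) set"
  where "T_Hinf = {g. g holomorphic_on ball 0 1 \<and> bounded_operator_Hinf (ball 0 1) (T_op g)}"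

text \<open>
  The common value of the integrals of \<open>f\<close> over all piecewise continuously differentiable paths
  in \<open>S\<close> from \<open>w\<^sub>0\<close> to \<open>w\<close>.  It exists uniquely when \<open>S\<close> is open and simply
  connected, \<open>w\<^sub>0\<close> and \<open>w\<close> are in \<open>S\<close> and \<open>f\<close> is holomorphic on \<open>S\<close>;
  see \<open>J_op_eq\<close> below.
\<close>

definition J_op ::
    "complex set \<Rightarrow> complex \<Rightarrow> (complex \<Rightarrow> complex) \<Rightarrow> complex \<Rightarrow> complex"
  where "J_op S w\<^sub>0 f w =
    (THE I. \<forall>p. valid_path p \<and> path_image p \<subseteq> S \<and> pathstart p = w\<^sub>0 \<and> pathfinish p = w
       \<longrightarrow> (f has_contour_integral I) p)"

lemma J_op_eq:
  assumes S: "open S" "simply_connected S" and f: "f holomorphic_on S"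
    and p: "valid_path p" "path_image p \<subseteq> S" "pathstart p = w\<^sub>0" "pathfinish p = w"
  shows "(f has_contour_integral J_op S w\<^sub>0 f w) p"
proof -
  obtain F where F: "\<And>z. z \<in> S \<Longrightarrow> (F has_field_derivative f z) (at z)"
    using simply_connected_eq_global_primitive[OF S(1)] S(2) f by blast
  have *: "(f has_contour_integral (F w - F w\<^sub>0)) q"
    if "valid_path q" "path_image q \<subseteq> S" "pathstart q = w\<^sub>0" "pathfinish q = w" for q
    using contour_integral_primitive[of S F f q] F that
    by (auto intro: has_field_derivative_at_within)
  have "J_op S w\<^sub>0 f w = F w - F w\<^sub>0"
    unfolding J_op_def
  proof (rule the_equality)
    show "I = F w - F w\<^sub>0"
      if "\<forall>q. valid_path q \<and> path_image q \<subseteq> S \<and> pathstart q = w\<^sub>0 \<and> pathfinish q = w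
            \<longrightarrow> (f has_contour_integral I) q" for I
      using that *[OF p] p has_contour_integral_unique by blast
  qed (use * in blast)
  then show ?thesis
    using *[OF p] by simp
qed

end

theory Submission
  imports Defs
begin

text \<open>
  The statement is a change of variables.  The integral of \<open>F\<close> over the image under \<open>g\<close> of
  the segment from \<open>0\<close> to \<open>z\<close> equals the integral of \<open>(F \<circ> g) g'\<close> over that segment.
  Since \<open>\<Omega>\<close> is simply connected, this image path may be used to compute
  \<open>J\<^bsub>g(0)\<^esub> F\<close> at its end point \<open>g z\<close>, and therefore
  \<open>T\<^sub>g (F \<circ> g) = (J\<^bsub>g(0)\<^esub> F) \<circ> g\<close> on the disk (\<open>T_op_eq_J_op\<close>).

  Because \<open>g\<close> is biholomorphic, \<open>F \<mapsto> F \<circ> g\<close> is an isometric isomorphism from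
  \<open>H\<^sup>\<infinity>(\<Omega>)\<close> onto \<open>H\<^sup>\<infinity>\<close> of the disk, and it conjugates one operator to the
  other, so that each is bounded when the other one is
  (\<open>bounded_operator_Hinf_transfer\<close>, used once for \<open>g\<close> and once for its inverse).
\<close>

lemma sup_norm_comp:
  assumes "\<phi> ` A = B" and "\<And>z. z \<in> A \<Longrightarrow> f z = F (\<phi> z)"
  shows "sup_norm A f = sup_norm B F"
proof -
  have "(\<lambda>z. norm (f z)) ` A = (\<lambda>w. norm (F w)) ` B"
    using assms by (auto simp: image_iff)
  then show ?thesis
    unfolding sup_norm_def by simp
qed

lemma Hinf_comp:
  assumes "\<phi> holomorphic_on A" and "\<phi> ` A \<subseteq> B" and "F \<in> Hinf B"
    and eq: "\<And>z. z \<in> A \<Longrightarrow> f z = F (\<phi> z)"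
  shows "f \<in> Hinf A"
proof -
  have "F \<circ> \<phi> holomorphic_on A"
    using assms(1-3) by (intro holomorphic_on_compose_gen) (auto simp: Hinf_def)
  then have "f holomorphic_on A"
    by (rule holomorphic_transform) (simp add: eq)
  moreover have "bounded (f ` A)"
  proof (rule bounded_subset)
    show "bounded (F ` B)"
      using assms(3) by (simp add: Hinf_def)
    show "f ` A \<subseteq> F ` B"
      using assms(2) eq by auto
  qed
  ultimately show ?thesis
    by (simp add: Hinf_def)
qed

text \<open>
  Functions that agree on \<open>A\<close> are different representatives of one element of
  \<open>H\<^sup>\<infinity>(A)\<close>.  The intertwining hypothesis is therefore stated for every
  representative \<open>f\<close> of \<open>F \<circ> \<phi>\<close>: it then also says that \<open>T\<close> depends on the values on
  \<open>A\<close> only, and in this form it is symmetric under replacing \<open>\<phi>\<close> by its inverse \<open>\<psi>\<close> and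
  exchanging the two operators.
\<close>

lemma bounded_operator_Hinf_transfer:
  assumes \<phi>: "\<phi> holomorphic_on A" "\<phi> ` A = B"
    and \<psi>: "\<psi> holomorphic_on B" "\<psi> ` B = A" "\<And>z. z \<in> A \<Longrightarrow> \<psi> (\<phi> z) = z"
    and intertwine: "\<And>f F z. \<lbrakk>f \<in> Hinf A; F \<in> Hinf B; \<And>t. t \<in> A \<Longrightarrow> f t = F (\<phi> t); z \<in> A\<rbrakk>
                       \<Longrightarrow> T f z = J F (\<phi> z)"
    and J: "bounded_operator_Hinf B J"
  shows "bounded_operator_Hinf A T"
proof -
  have pull: "(\<lambda>w. f (\<psi> w)) \<in> Hinf B" if "f \<in> Hinf A" for f
    by (rule Hinf_comp[OF \<psi>(1) _ that]) (simp_all add: \<psi>(2))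
  have T_eq: "T f z = J (\<lambda>w. f (\<psi> w)) (\<phi> z)" if "f \<in> Hinf A" "z \<in> A" for f z
    by (rule intertwine[OF that(1) pull[OF that(1)] _ that(2)]) (simp add: \<psi>(3))
  have \<phi>B: "\<phi> z \<in> B" if "z \<in> A" for z
    using that \<phi>(2) by blast
  have J_Hinf: "J F \<in> Hinf B" if "F \<in> Hinf B" for F
    using J that by (simp add: bounded_operator_Hinf_def)
  have J_add: "J (\<lambda>w. F w + G w) w = J F w + J G w"
    if "F \<in> Hinf B" "G \<in> Hinf B" "w \<in> B" for F G w
    using J that by (simp add: bounded_operator_Hinf_def)
  have J_scale: "J (\<lambda>w. c * F w) w = c * J F w" if "F \<in> Hinf B" "w \<in> B" for F c w
    using J that by (simp add: bounded_operator_Hinf_def)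
  obtain C where C: "\<And>F. F \<in> Hinf B \<Longrightarrow> sup_norm B (J F) \<le> C * sup_norm B F"
    using J unfolding bounded_operator_Hinf_def by blast
  have Hinf_add: "(\<lambda>t. f t + h t) \<in> Hinf A" if "f \<in> Hinf A" "h \<in> Hinf A" for f h
    using that by (auto simp: Hinf_def intro!: holomorphic_intros bounded_plus_comp)
  have Hinf_scale: "(\<lambda>t. c * f t) \<in> Hinf A" if "f \<in> Hinf A" for f and c :: complex
  proof -
    have "bounded ((\<lambda>x. c * x) ` f ` A)"
      by (rule bounded_linear_image[OF _ bounded_linear_mult_right]) (use that in \<open>simp add: Hinf_def\<close>)
    then show ?thesis
      using that by (auto simp: Hinf_def image_image intro!: holomorphic_intros)
  qed
  show ?thesis
    unfolding bounded_operator_Hinf_def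
  proof (intro conjI ballI allI exI[of _ C])
    fix f assume f: "f \<in> Hinf A"
    show "T f \<in> Hinf A"
      by (rule Hinf_comp[OF \<phi>(1) _ J_Hinf[OF pull[OF f]]]) (simp_all add: \<phi>(2) T_eq[OF f])
    show "T (\<lambda>t. c * f t) z = c * T f z" if "z \<in> A" for c z
      using that by (simp add: T_eq f Hinf_scale J_scale pull \<phi>B)
    show "T (\<lambda>t. f t + h t) z = T f z + T h z" if "h \<in> Hinf A" "z \<in> A" for h z
      using that by (simp add: T_eq f Hinf_add J_add pull \<phi>B)
    have "sup_norm A (T f) = sup_norm B (J (\<lambda>w. f (\<psi> w)))"
      by (rule sup_norm_comp[OF \<phi>(2)]) (rule T_eq[OF f])
    also have "\<dots> \<le> C * sup_norm B (\<lambda>w. f (\<psi> w))"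
      by (rule C[OF pull[OF f]])
    also have "sup_norm B (\<lambda>w. f (\<psi> w)) = sup_norm A f"
      by (rule sup_norm_comp[OF \<psi>(2)]) simp
    finally show "sup_norm A (T f) \<le> C * sup_norm A f" .
  qed
qed

text \<open>
  The image under \<open>g\<close> of the segment from \<open>0\<close> to \<open>z\<close> is one of the paths along which
  \<open>J_op\<close> may be evaluated.
\<close>

lemma T_op_eq_J_op:
  assumes \<Omega>: "open \<Omega>" "simply_connected \<Omega>"
    and g: "g holomorphic_on ball 0 1" "g ` ball 0 1 \<subseteq> \<Omega>"
    and F: "F holomorphic_on \<Omega>" and f: "\<And>t. t \<in> ball 0 1 \<Longrightarrow> f t = F (g t)"
    and z: "z \<in> ball 0 1"
  shows "T_op g f z = J_op \<Omega> (g 0) F (g z)"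
proof -
  have seg: "path_image (linepath 0 z) \<subseteq> ball 0 1"
    using z by (simp add: closed_segment_subset)
  let ?p = "g \<circ> linepath 0 z"
  have "(F has_contour_integral J_op \<Omega> (g 0) F (g z)) ?p"
  proof (rule J_op_eq[OF \<Omega> F])
    show "valid_path ?p"
      using g(1) seg by (intro valid_path_compose_holomorphic[of _ _ "ball 0 1"]) auto
    show "path_image ?p \<subseteq> \<Omega>"
      using g(2) seg by (auto simp: path_image_compose)
  qed (simp_all add: pathstart_compose pathfinish_compose)
  then have "J_op \<Omega> (g 0) F (g z) = contour_integral ?p F"
    by (simp add: contour_integral_unique)
  also have "\<dots> = contour_integral (linepath 0 z) (\<lambda>t. deriv g t * F (g t))"
    using g(1) seg
    by (intro contour_integral_comp_analyticW[of _ "ball 0 1"]) (auto simp: analytic_on_open)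
  also have "\<dots> = T_op g f z"
    unfolding T_op_def using seg f by (intro contour_integral_cong) (auto simp: mult.commute)
  finally show ?thesis ..
qed

theorem proposition2p13:
  fixes \<Omega> :: "complex set" and g :: "complex \<Rightarrow> complex"
  assumes "open \<Omega>" and "simply_connected \<Omega>" and "\<Omega> \<noteq> UNIV"
    and "g holomorphic_on ball 0 1" and "inj_on g (ball 0 1)" and "g ` ball 0 1 = \<Omega>"
  shows "g \<in> T_Hinf \<longleftrightarrow> bounded_operator_Hinf \<Omega> (J_op \<Omega> (g 0))"
proof -
  obtain h where h: "h holomorphic_on \<Omega>" and hg: "\<And>z. z \<in> ball 0 1 \<Longrightarrow> h (g z) = z"
    using holomorphic_has_inverse[OF assms(4) open_ball assms(5)] assms(6) by metis
  have h_im: "h ` \<Omega> = ball 0 1"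
    using assms(6) hg by force
  have gh: "g (h w) = w" if "w \<in> \<Omega>" for w
    using that assms(6) hg by force
  have T_J: "T_op g f z = J_op \<Omega> (g 0) F (g z)"
    if "F \<in> Hinf \<Omega>" "\<And>t. t \<in> ball 0 1 \<Longrightarrow> f t = F (g t)" "z \<in> ball 0 1" for f F z
    using that assms(6)
    by (intro T_op_eq_J_op[OF assms(1,2,4)]) (auto simp: Hinf_def)
  have "bounded_operator_Hinf (ball 0 1) (T_op g)"
    if "bounded_operator_Hinf \<Omega> (J_op \<Omega> (g 0))"
    using bounded_operator_Hinf_transfer[OF assms(4,6) h h_im hg T_J that] .
  moreover have "bounded_operator_Hinf \<Omega> (J_op \<Omega> (g 0))"
    if T: "bounded_operator_Hinf (ball 0 1) (T_op g)"
  proof (rule bounded_operator_Hinf_transfer[OF h h_im assms(4,6) gh _ T])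
    fix F f w
    assume F: "F \<in> Hinf \<Omega>" and eq: "\<And>t. t \<in> \<Omega> \<Longrightarrow> F t = f (h t)" and w: "w \<in> \<Omega>"
    have "f t = F (g t)" if "t \<in> ball 0 1" for t
      using eq[of "g t"] hg[OF that] that assms(6) by auto
    then have "T_op g f (h w) = J_op \<Omega> (g 0) F (g (h w))"
      using w h_im by (intro T_J[OF F]) auto
    then show "J_op \<Omega> (g 0) F w = T_op g f (h w)"
      by (simp add: gh w)
  qed
  ultimately show ?thesis
    using assms(4) by (auto simp: T_Hinf_def)
qed

end
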